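(* In the setting of the context, the sequences of rational functions $\{\varphi_j(z)\}_{j\ge0}$ and $\{\tilde\psi_j(z)\}_{j\ge0}$ satisfy the following biorthogonality relations ($n,m\ge0$): $$\mathfrak{N}\big(\varphi_{2n}(z)\cdot\tilde\psi_m(z)\big)=\frac{c_2c_3\cdots c_{2n+1}\,(m_1\kappa_0-m_0\kappa_1)}{\chi_{2n+1}}\,\delta_{2n,m},$$ $$\mathfrak{N}\big(\varphi_{2n+1}(z)\cdot\tilde\psi_m(z)\big)=\frac{c_2c_3\cdots c_{2n+2}\,(m_1\kappa_0-m_0\kappa_1)}{\chi_{2n+2}}\,\delta_{2n+1,m},$$ where $m_j=\mathfrak{N}(z^j\mathcal{O}_j(z))$ and $\kappa_j$ is the leading coefficient of $r_j(z)$, i.e. $r_j(z)=\kappa_jz^j+\text{lower order terms}$.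
   Context: Let $\{\alpha_j\}_{j\ge1}$, $\{\beta_j\}_{j\ge1}$ be sequences in $\mathbb{C}\setminus\{0\}$ and $\beta_0:=0$. The rational functions $\varphi_j$ are the orthonormal functions (with respect to an inner product $\langle f,g\rangle=\mathfrak{L}(f g_* )$, $g_*(z)=\overline{g(1/\bar z)}$, given by a Hermitian positive-definite linear functional $\mathfrak{L}$) obtained by Gram–Schmidt from $\mathfrak{u}_{2j}(z)=z^{2j}/\big(\prod_{k=1}^{j}(z-\alpha_k)\prod_{k=1}^{j}(1-z\bar\beta_k)\big)$, $\mathfrak{u}_{2j+1}(z)=\frac{z}{z-\alpha_{j+1}}\mathfrak{u}_{2j}(z)$, $j\ge0$. They have the form $\varphi_0=1$, $$\varphi_{2j}(z)=\frac{r_{2j}(z)}{\prod_{k=1}^{j}(z-\alpha_k)\prod_{k=1}^{j}(1-z\bar\beta_k)},\qquad \varphi_{2j+1}(z)=\frac{r_{2j+1}(z)}{\prod_{k=1}^{j+1}(z-\alpha_k)\prod_{k=1}^{j}(1-z\bar\beta_k)},$$ with polynomials $r_n$ of degree at most $n$, $r_0=1$, and there are constants $e_j,d_j\in\mathbb{C}$, $c_j\in\mathbb{C}\setminus\{0\}$ such that, for $n\ge0$ and with $r_{-1}:=0$ (so that no $\alpha_0$ is needed), $$r_{2n+1}(z)=[e_{2n+1}+d_{2n+1}(z-\beta_n)]r_{2n}(z)+c_{2n+1}(1-z\bar\alpha_n)(1-z\bar\beta_n)r_{2n-1}(z),$$ $$r_{2n+2}(z)=[e_{2n+2}+d_{2n+2}(1-z\bar\alpha_{n+1})]r_{2n+1}(z)+c_{2n+2}(z-\alpha_{n+1})(z-\beta_n)r_{2n}(z).$$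 Standing regularity assumptions: $r_{2n}(\alpha_n)\ne0$, $r_{2n}(1/\bar\beta_n)\ne0$, $r_{2n}(\beta_{n-1})\neq0$, $r_{2n}(1/\bar\alpha_n)\ne0$ for $n\ge1$; $r_{2n+1}(\alpha_{n+1})\ne0$, $r_{2n+1}(\beta_n)\ne0$ for $n\ge0$; $r_{2n+1}(1/\bar\beta_n)\ne0$, $r_{2n+1}(1/\bar\alpha_n)\ne0$ for $n\ge1$. Define $\mathcal{O}_0(z)=1$ and, for $n\ge0$, $$\mathcal{O}_{2n+1}(z)=\frac{r_{2n+1}(z)}{\prod_{j=1}^{n+1}(z-\alpha_j)\prod_{j=1}^{n}(1-z\bar\alpha_j)\prod_{j=0}^{n}(z-\beta_j)\prod_{j=1}^{n}(1-z\bar\beta_j)},$$ $$\mathcal{O}_{2n+2}(z)=\frac{r_{2n+2}(z)}{\prod_{j=1}^{n+1}(z-\alpha_j)\prod_{j=1}^{n+1}(1-z\bar\alpha_j)\prod_{j=0}^{n}(z-\beta_j)\prod_{j=1}^{n+1}(1-z\bar\beta_j)}.$$ $\mathfrak{N}$ is a linear functional on the span of the functions $z^k\mathcal{O}_n(z)$ with $\mathfrak{N}(z^k\mathcal{O}_n(z))=0$ for $k=0,1,\dots,n-1$. Put $m_0=\mathfrak{N}(1)$ and $m_n=\mathfrak{N}(z^n\mathcal{O}_n(z))$ for $n\ge1$; these numbers satisfy, for $n\ge1$, $\bar\alpha_n\bar\beta_nm_{2n}+d_{2n}\bar\alpha_nm_{2n-1}-c_{2n}m_{2n-2}=0$ and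 $m_{2n+1}-d_{2n+1}m_{2n}-c_{2n+1}m_{2n-1}=0$. The initial values $m_0,m_1$ are chosen with $m_1\ne d_1m_0$, i.e. $\kappa_0m_1-\kappa_1m_0\neq0$ (since $\kappa_0=1$, $\kappa_1=d_1$). Define $\tilde\varphi_0(z)=1$ and, for $n\ge0$, $$\tilde\varphi_{2n+1}(z)=\frac{r_{2n+1}(z)}{\prod_{j=1}^{n}(1-z\bar\alpha_j)\prod_{j=0}^{n}(z-\beta_j)},\qquad \tilde\varphi_{2n+2}(z)=\frac{r_{2n+2}(z)}{\prod_{j=1}^{n+1}(1-z\bar\alpha_j)\prod_{j=0}^{n}(z-\beta_j)} .$$ Let $\chi_{2m}=\bar\alpha_1(\bar\beta_1)^{-1}\cdots\bar\alpha_m(\bar\beta_m)^{-1}$, $\chi_{2m+1}=\bar\alpha_1(\bar\beta_1)^{-1}\cdots\bar\alpha_m(\bar\beta_m)^{-1}\bar\alpha_{m+1}$, and $\tilde{\mathcal{J}}_m(z)=\chi_m^{-1}\tilde\varphi_m(z)$. Define $\tilde\psi_0(z):=1$ and $$\tilde\psi_{2j}(z)=\frac{c_{2j+1}(\bar\beta_j)^{2}}{\bar\alpha_{j+1}}\tilde{\mathcal{J}}_{2j-1}(z)-\frac{d_{2j+1}}{\bar\alpha_{j+1}}\tilde{\mathcal{J}}_{2j}(z)+\tilde{\mathcal{J}}_{2j+1}(z),\qquad j\ge1,$$ $$\tilde\psi_{2j+1}(z)=\frac{c_{2j+2}\bar\beta_{j+1}}{\bar\alpha_{j+1}}\tilde{\mathcal{J}}_{2j}(z)-d_{2j+2}\bar\alpha_{j+1}\bar\beta_{j+1}\tilde{\mathcal{J}}_{2j+1}(z)+\bar\alpha_{j+1}\tilde{\mathcal{J}}_{2j+2}(z),\qquad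 j\ge0.$$
   Formalization: With ψ̃_0 := 1 as printed, the relations for m = 0 would force m_0 = m_1 = 0, against m_1 ≠ d_1 m_0; here ψ̃_0 is instead given by the even formula at j = 0, i.e. ψ̃_0 = −(d_1/ᾱ_1) J̃_0 + J̃_1. All ψ̃_m with m ≥ 1 are as printed. *)

theory Defs
  imports Complex_Main "HOL-Computational_Algebra.Computational_Algebra"
    "HOL-Computational_Algebra.Field_as_Ring"
begin

text \<open>
  Rational functions are elements of the field of fractions of the complex polynomials, so that
  products and identities are those of rational functions, with no convention needed at poles.
\<close>

type_synonym ratfun = "complex poly fract"

definition rscale :: "complex \<Rightarrow> ratfun \<Rightarrow> ratfun" where
  "rscale a f = to_fract [:a:] * f"

interpretation ratfun: vector_space rscale
proof
  fix a b :: complex and x y :: ratfun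
  show "rscale a (x + y) = rscale a x + rscale a y"
    by (simp add: rscale_def distrib_left)
  have "[:a + b:] = [:a:] + [:b:]" by simp
  then show "rscale (a + b) x = rscale a x + rscale b x"
    unfolding rscale_def by (metis to_fract_add distrib_right)
  have "[:a * b:] = [:a:] * [:b:]" by simp
  then show "rscale a (rscale b x) = rscale (a * b) x"
    unfolding rscale_def by (metis to_fract_mult mult.assoc)
  have "[:1::complex:] = 1" by simp
  then show "rscale 1 x = x"
    unfolding rscale_def by (metis to_fract_1 mult_1)
qed

definition linear_functional_on :: "ratfun set \<Rightarrow> (ratfun \<Rightarrow> complex) \<Rightarrow> bool" where
  "linear_functional_on V F \<longleftrightarrow>
     (\<forall>f\<in>V. \<forall>g\<in>V. F (f + g) = F f + F g) \<and> (\<forall>a. \<forall>f\<in>V. F (rscale a f) = a * F f)"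


text \<open>
  The substar conjugate \<open>g\<^sub>*(z) = cnj (g (1 / cnj z))\<close>. For a polynomial
  \<open>p = (\<Sum>i\<le>n. a\<^sub>i z ^ i)\<close> of degree \<open>n\<close> this is
  \<open>(\<Sum>i\<le>n. cnj a\<^sub>i z ^ (n - i)) / z ^ n\<close>. By \<open>substar_Fract\<close> below, the value on a quotient
  does not depend on the choice of numerator and denominator.
\<close>

definition poly_substar :: "complex poly \<Rightarrow> ratfun" where
  "poly_substar p = Fract (reflect_poly (map_poly cnj p)) (monom 1 (degree p))"

definition substar :: "ratfun \<Rightarrow> ratfun" where
  "substar f = (case quot_of_fract f of (p, q) \<Rightarrow> poly_substar p / poly_substar q)"

lemma poly_substar_mult: "poly_substar (p * q) = poly_substar p * poly_substar q"
proof (cases "p = 0 \<or> q = 0")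
  case True
  then show ?thesis by (auto simp: poly_substar_def fract_collapse)
next
  case False
  have "map_poly cnj (p * q) = map_poly cnj p * map_poly cnj q"
    by (rule poly_eqI) (simp add: coeff_map_poly coeff_mult)
  with False show ?thesis
    by (simp add: poly_substar_def reflect_poly_mult degree_mult_eq mult_monom)
qed

lemma poly_substar_eq_0_iff: "poly_substar p = 0 \<longleftrightarrow> p = 0"
proof -
  have "map_poly cnj p = 0 \<longleftrightarrow> p = 0"
    by (rule map_poly_eq_0_iff) auto
  then show ?thesis
    by (simp add: poly_substar_def Zero_fract_def eq_fract)
qed

lemma substar_Fract:
  assumes "q \<noteq> 0"
  shows "substar (Fract p q) = poly_substar p / poly_substar q"
proof -
  obtain p' q' where pq: "quot_of_fract (Fract p q) = (p', q')"
    by (cases "quot_of_fract (Fract p q)")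
  have q': "q' \<noteq> 0"
    using snd_quot_of_fract_nonzero[of "Fract p q"] pq by simp
  have "Fract p' q' = Fract p q"
    using quot_to_fract_quot_of_fract[of "Fract p q"] pq by (simp add: quot_to_fract_def)
  then have "p' * q = p * q'"
    using assms q' by (simp add: eq_fract)
  then have "poly_substar p' * poly_substar q = poly_substar p * poly_substar q'"
    by (metis poly_substar_mult)
  then show ?thesis
    using assms q' by (simp add: substar_def pq frac_eq_eq poly_substar_eq_0_iff)
qed

definition inner_prod :: "(ratfun \<Rightarrow> complex) \<Rightarrow> ratfun \<Rightarrow> ratfun \<Rightarrow> complex" where
  "inner_prod L f g = L (f * substar g)"

definition hermitian_posdef_functional :: "ratfun set \<Rightarrow> (ratfun \<Rightarrow> complex) \<Rightarrow> bool" where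
  "hermitian_posdef_functional V L \<longleftrightarrow>
     (let W = ratfun.span {f * substar g | f g. f \<in> V \<and> g \<in> V} in
       linear_functional_on W L \<and>
       (\<forall>h\<in>W. L (substar h) = cnj (L h)) \<and>
       (\<forall>f\<in>V. f \<noteq> 0 \<longrightarrow> Im (L (f * substar f)) = 0 \<and> 0 < Re (L (f * substar f))))"


text \<open>The polynomials \<open>z - a\<close> and \<open>1 - z cnj a\<close>.\<close>

definition lin :: "complex \<Rightarrow> complex poly" where
  "lin a = [:- a, 1:]"

definition rlin :: "complex \<Rightarrow> complex poly" where
  "rlin a = [:1, - cnj a:]"

definition u_even :: "(nat \<Rightarrow> complex) \<Rightarrow> (nat \<Rightarrow> complex) \<Rightarrow> nat \<Rightarrow> ratfun" where
  "u_even \<alpha> \<beta> j = Fract (monom 1 (2 * j)) ((\<Prod>k=1..j. lin (\<alpha> k)) * (\<Prod>k=1..j. rlin (\<beta> k)))"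

definition u_basis :: "(nat \<Rightarrow> complex) \<Rightarrow> (nat \<Rightarrow> complex) \<Rightarrow> nat \<Rightarrow> ratfun" where
  "u_basis \<alpha> \<beta> n =
     (if even n then u_even \<alpha> \<beta> (n div 2)
      else Fract [:0, 1:] (lin (\<alpha> (n div 2 + 1))) * u_even \<alpha> \<beta> (n div 2))"

text \<open>
  Each Gram--Schmidt step determines \<open>\<phi> n\<close> up to a factor of modulus one; no normalisation of
  this factor is imposed.
\<close>

definition gram_schmidt ::
  "(ratfun \<Rightarrow> complex) \<Rightarrow> (nat \<Rightarrow> ratfun) \<Rightarrow> (nat \<Rightarrow> ratfun) \<Rightarrow> bool" where
  "gram_schmidt L u \<phi> \<longleftrightarrow>
     (\<forall>n. let v = u n - (\<Sum>k<n. rscale (inner_prod L (u n) (\<phi> k)) (\<phi> k)) in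
        \<exists>\<epsilon>. cmod \<epsilon> = 1 \<and>
          \<phi> n = rscale (\<epsilon> / complex_of_real (sqrt (Re (inner_prod L v v)))) v)"


text \<open>\<open>f (n - 1)\<close>, with the convention \<open>f (- 1) = 0\<close>.\<close>

definition prev :: "(nat \<Rightarrow> 'a::zero) \<Rightarrow> nat \<Rightarrow> 'a" where
  "prev f n = (if n = 0 then 0 else f (n - 1))"

text \<open>
  In the following three definitions the indices \<open>2 n + 1\<close> and \<open>2 n + 2\<close> are treated uniformly:
  \<open>(n + 1) div 2\<close> and \<open>n div 2\<close> are the number of odd, respectively even, indices in \<open>{1..n}\<close>,
  and \<open>\<Prod>j<(n + 1) div 2. lin (\<beta> j)\<close> starts at \<open>j = 0\<close>.
\<close>

definition ratO ::
  "(nat \<Rightarrow> complex) \<Rightarrow> (nat \<Rightarrow> complex) \<Rightarrow> (nat \<Rightarrow> complex poly) \<Rightarrow> nat \<Rightarrow> ratfun" where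
  "ratO \<alpha> \<beta> r n =
     (if n = 0 then 1
      else Fract (r n)
        ((\<Prod>j=1..(n + 1) div 2. lin (\<alpha> j)) * (\<Prod>j=1..n div 2. rlin (\<alpha> j)) *
         (\<Prod>j<(n + 1) div 2. lin (\<beta> j)) * (\<Prod>j=1..n div 2. rlin (\<beta> j))))"

text \<open>The functions \<open>z ^ k * \<O>\<^sub>n\<close>.\<close>

definition zO ::
  "(nat \<Rightarrow> complex) \<Rightarrow> (nat \<Rightarrow> complex) \<Rightarrow> (nat \<Rightarrow> complex poly) \<Rightarrow> nat \<Rightarrow> nat \<Rightarrow> ratfun" where
  "zO \<alpha> \<beta> r k n = to_fract (monom 1 k) * ratO \<alpha> \<beta> r n"

definition phi_tilde ::
  "(nat \<Rightarrow> complex) \<Rightarrow> (nat \<Rightarrow> complex) \<Rightarrow> (nat \<Rightarrow> complex poly) \<Rightarrow> nat \<Rightarrow> ratfun" where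
  "phi_tilde \<alpha> \<beta> r n =
     (if n = 0 then 1
      else Fract (r n) ((\<Prod>j=1..n div 2. rlin (\<alpha> j)) * (\<Prod>j<(n + 1) div 2. lin (\<beta> j))))"

definition chi :: "(nat \<Rightarrow> complex) \<Rightarrow> (nat \<Rightarrow> complex) \<Rightarrow> nat \<Rightarrow> complex" where
  "chi \<alpha> \<beta> n = (\<Prod>k=1..n div 2. cnj (\<alpha> k) / cnj (\<beta> k)) *
     (if odd n then cnj (\<alpha> (n div 2 + 1)) else 1)"

definition J_tilde ::
  "(nat \<Rightarrow> complex) \<Rightarrow> (nat \<Rightarrow> complex) \<Rightarrow> (nat \<Rightarrow> complex poly) \<Rightarrow> nat \<Rightarrow> ratfun" where
  "J_tilde \<alpha> \<beta> r n = rscale (1 / chi \<alpha> \<beta> n) (phi_tilde \<alpha> \<beta> r n)"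

text \<open>
  The even formula is used for \<open>j = 0\<close> as well, with \<open>J (- 1) = 0\<close> (immaterial, since its
  coefficient contains \<open>\<beta> 0 = 0\<close>). Replacing \<open>psi_tilde 0\<close> by the constant \<open>1\<close> would contradict
  biorthogonality: \<open>\<NN> (\<phi> 1) = m 1\<close> and \<open>\<NN> (\<phi> 2) = - cnj (\<alpha> 1) * m 2\<close> would both have to
  vanish, hence also \<open>m 0 = 0\<close>, against \<open>m 1 \<noteq> d 1 * m 0\<close>.
\<close>

definition psi_tilde ::
  "(nat \<Rightarrow> complex) \<Rightarrow> (nat \<Rightarrow> complex) \<Rightarrow> (nat \<Rightarrow> complex) \<Rightarrow> (nat \<Rightarrow> complex) \<Rightarrow>
   (nat \<Rightarrow> complex poly) \<Rightarrow> nat \<Rightarrow> ratfun" where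
  "psi_tilde \<alpha> \<beta> c d r n =
     (let j = n div 2; J = J_tilde \<alpha> \<beta> r in
      if even n then
        rscale (c (2 * j + 1) * (cnj (\<beta> j))\<^sup>2 / cnj (\<alpha> (j + 1))) (prev J (2 * j))
        - rscale (d (2 * j + 1) / cnj (\<alpha> (j + 1))) (J (2 * j))
        + J (2 * j + 1)
      else
        rscale (c (2 * j + 2) * cnj (\<beta> (j + 1)) / cnj (\<alpha> (j + 1))) (J (2 * j))
        - rscale (d (2 * j + 2) * cnj (\<alpha> (j + 1)) * cnj (\<beta> (j + 1))) (J (2 * j + 1))
        + rscale (cnj (\<alpha> (j + 1))) (J (2 * j + 2)))"

end

theory Submission
  imports Defs
begin

text \<open>
  Write \<open>A n\<close> and \<open>T n\<close> for the denominators of \<open>\<phi> n\<close> and \<open>phi_tilde n\<close>, so that \<open>A n * T n\<close> is the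
  denominator of \<open>ratO n\<close>. Passing from \<open>n\<close> to \<open>Suc n\<close> multiplies each of them by one linear factor,
  \<open>f n\<close> and \<open>g n\<close> respectively, and in terms of these both recurrences take the single form
  \<open>r (n + 2) = q (n + 1) * r (n + 1) + c (n + 2) * f n * g n * r n\<close>. Since \<open>\<NN> (p * ratO n)\<close> is
  \<open>m n\<close> times the \<open>n\<close>-th coefficient of \<open>p\<close>, the number \<open>\<NN> (\<phi> k * phi_tilde l)\<close> only sees leading
  coefficients. The three terms of \<open>psi_tilde l\<close> cancel for \<open>k < l\<close> by the recurrence of the
  moments \<open>m\<close>, and for \<open>k > l\<close> by that of the leading coefficients; on the diagonal they leave a Casorati
  determinant of these two recurrences, which changes by the factor \<open>- c (l + 2)\<close> from \<open>l\<close> to \<open>l + 1\<close>.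
\<close>

section \<open>Top coefficients of products under degree bounds\<close>

lemma coeff_mult_at_bounds:
  fixes p q :: "'a::comm_semiring_0 poly"
  assumes "degree p \<le> i" "degree q \<le> j"
  shows "coeff (p * q) (i + j) = coeff p i * coeff q j"
proof -
  have "coeff p k * coeff q (i + j - k) = 0" if "k \<in> {..i + j} - {i}" for k
  proof (cases "k < i")
    case True
    then have "coeff q (i + j - k) = 0"
      using assms(2) by (intro coeff_eq_0) linarith
    then show ?thesis by simp
  next
    case False
    then have "coeff p k = 0"
      using assms(1) that by (intro coeff_eq_0) auto
    then show ?thesis by simp
  qed
  then have "coeff (p * q) (i + j) = (\<Sum>k\<in>{i}. coeff p k * coeff q (i + j - k))"
    unfolding coeff_mult by (intro sum.mono_neutral_right) auto
  then show ?thesis by simp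
qed

lemma prod_linear_top_coeff:
  fixes f :: "nat \<Rightarrow> 'a::comm_semiring_1 poly"
  assumes "\<And>i. degree (f i) \<le> 1" "k \<le> n"
  shows "degree (\<Prod>i=k..<n. f i) \<le> n - k"
    and "coeff (\<Prod>i=k..<n. f i) (n - k) = (\<Prod>i=k..<n. coeff (f i) 1)"
proof -
  \<comment> \<open>The two claims share one induction, since reading off the top coefficient of
    \<open>?P * f n\<close> uses the degree bound on \<open>?P\<close>.\<close>
  have "degree (\<Prod>i=k..<n. f i) \<le> n - k \<and>
      coeff (\<Prod>i=k..<n. f i) (n - k) = (\<Prod>i=k..<n. coeff (f i) 1)"
    using assms(2)
  proof (induction n rule: dec_induct)
    case base
    show ?case by simp
  next
    case (step n)
    let ?P = "\<Prod>i=k..<n. f i"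
    have "degree (?P * f n) \<le> degree ?P + degree (f n)"
      by (rule degree_mult_le)
    then have "degree (?P * f n) \<le> Suc n - k"
      using step assms(1)[of n] by linarith
    moreover have "coeff (?P * f n) (n - k + 1) = coeff ?P (n - k) * coeff (f n) 1"
      using step assms(1) by (intro coeff_mult_at_bounds) auto
    ultimately show ?case
      using step by (simp add: Suc_diff_le)
  qed
  then show "degree (\<Prod>i=k..<n. f i) \<le> n - k"
    "coeff (\<Prod>i=k..<n. f i) (n - k) = (\<Prod>i=k..<n. coeff (f i) 1)" by auto
qed

section \<open>Scalars and linear functionals on rational functions\<close>

lemma rscale_mult_left: "rscale a x * y = rscale a (x * y)"
  by (simp add: rscale_def mult.assoc)

lemma rscale_mult_right: "x * rscale a y = rscale a (x * y)"
  by (simp add: rscale_def ac_simps)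

lemma to_fract_smult: "to_fract (smult a p) = rscale a (to_fract p)"
proof -
  have "smult a p = [:a:] * p" by simp
  then show ?thesis unfolding rscale_def by (metis to_fract_mult)
qed

lemma linear_functional_on_diff:
  assumes "linear_functional_on (ratfun.span S) F" "x \<in> ratfun.span S" "y \<in> ratfun.span S"
  shows "F (x - y) = F x - F y"
proof -
  have "F ((x - y) + y) = F (x - y) + F y"
    using assms ratfun.span_diff unfolding linear_functional_on_def by metis
  then show ?thesis by simp
qed

lemma linear_functional_on_sum_rscale:
  assumes "linear_functional_on (ratfun.span S) F" "finite I" "\<And>i. i \<in> I \<Longrightarrow> v i \<in> ratfun.span S"
  shows "F (\<Sum>i\<in>I. rscale (a i) (v i)) = (\<Sum>i\<in>I. a i * F (v i))"
  using assms(2,3)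
proof (induction I rule: finite_induct)
  case empty
  have "F (rscale 0 0) = 0 * F 0"
    using assms(1) ratfun.span_zero unfolding linear_functional_on_def by metis
  then show ?case by simp
next
  case (insert i I)
  have "(\<Sum>i\<in>I. rscale (a i) (v i)) \<in> ratfun.span S"
    using insert by (intro ratfun.span_sum ratfun.span_scale) auto
  moreover have "rscale (a i) (v i) \<in> ratfun.span S"
    using insert by (intro ratfun.span_scale) auto
  ultimately show ?case
    using insert assms(1) by (simp add: linear_functional_on_def)
qed

section \<open>The recurrence in terms of linear factors\<close>

locale linear_factor_recurrence =
  fixes f g q r :: "nat \<Rightarrow> complex poly" and c :: "nat \<Rightarrow> complex"
    and F :: "ratfun \<Rightarrow> complex" and R :: "nat \<Rightarrow> ratfun" and S :: "ratfun set"
  assumes f_nz: "f n \<noteq> 0" and g_nz: "g n \<noteq> 0"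
    and f_degree: "degree (f n) \<le> 1" and g_degree: "degree (g n) \<le> 1"
    and q_degree: "degree (q n) \<le> 1" and r_degree: "degree (r n) \<le> n"
    and r_1: "r 1 = q 0 * r 0"
    and r_rec: "r (Suc (Suc n)) = q (Suc n) * r (Suc n) + smult (c (Suc (Suc n))) (f n * g n * r n)"
    and R_eq: "R n = Fract (r n) ((\<Prod>i<n. f i) * (\<Prod>i<n. g i))"
    and S_eq: "S = {to_fract (monom 1 k) * R n | k n. k \<le> n}"
    and F: "linear_functional_on (ratfun.span S) F"
    and F_orth: "k < n \<Longrightarrow> F (to_fract (monom 1 k) * R n) = 0"
begin

definition moment :: "nat \<Rightarrow> complex" where
  "moment n = F (to_fract (monom 1 n) * R n)"

definition lc :: "nat \<Rightarrow> complex" where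
  "lc n = coeff (r n) n"

definition Phi :: "nat \<Rightarrow> ratfun" where
  "Phi n = Fract (r n) (\<Prod>i<n. f i)"

definition Phit :: "nat \<Rightarrow> ratfun" where
  "Phit n = Fract (r n) (\<Prod>i<n. g i)"

text \<open>This is \<open>psi_tilde l\<close> freed of the scalar
  \<open>(- 1) ^ l / chi (Suc l)\<close>, so that its coefficients involve only \<open>c\<close> and
  the top coefficients of \<open>f\<close>, \<open>g\<close> and \<open>q\<close>. The case split
  plays the role of a vanishing term of index -1.\<close>

definition Psi :: "nat \<Rightarrow> ratfun" where
  "Psi l = rscale (coeff (g l) 1) (Phit (Suc l)) - rscale (coeff (q l) 1) (Phit l)
     - (case l of 0 \<Rightarrow> 0 | Suc k \<Rightarrow> rscale (c (Suc l) * coeff (f k) 1) (Phit k))"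

text \<open>Multiplying \<open>moment n\<close> by the product of
  \<open>coeff (f i) 1 * coeff (g i) 1\<close> over \<open>i < n\<close> yields a solution of the
  recurrence \<open>lc_rec\<close>. The formula is the 2 by 2 Casorati determinant of
  \<open>lc\<close> and this solution, with the product over \<open>i < l\<close> taken out.\<close>

definition casorati :: "nat \<Rightarrow> complex" where
  "casorati l = coeff (f l) 1 * coeff (g l) 1 * lc l * moment (Suc l) - lc (Suc l) * moment l"

lemma poly_mult_R:
  assumes "degree p \<le> n"
  shows "to_fract p * R n \<in> ratfun.span S"
    and "F (to_fract p * R n) = coeff p n * moment n"
proof -
  have mem: "to_fract (monom 1 k) * R n \<in> ratfun.span S" if "k \<le> n" for k
    using that S_eq by (intro ratfun.span_base) auto
  have "p = (\<Sum>k\<le>n. monom (coeff p k) k)"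
    using poly_as_sum_of_monoms'[OF assms] by simp
  also have "\<dots> = (\<Sum>k\<le>n. smult (coeff p k) (monom 1 k))"
    by (simp add: smult_monom)
  finally have "to_fract p * R n = (\<Sum>k\<le>n. rscale (coeff p k) (to_fract (monom 1 k))) * R n"
    by (metis (mono_tags, lifting) sum.cong to_fract_smult to_fract_sum)
  then have eq: "to_fract p * R n = (\<Sum>k\<le>n. rscale (coeff p k) (to_fract (monom 1 k) * R n))"
    by (simp add: sum_distrib_right rscale_mult_left)
  show "to_fract p * R n \<in> ratfun.span S"
    unfolding eq using mem by (intro ratfun.span_sum ratfun.span_scale) auto
  have "F (to_fract p * R n) = (\<Sum>k\<le>n. coeff p k * F (to_fract (monom 1 k) * R n))"
    unfolding eq using mem by (intro linear_functional_on_sum_rscale[OF F]) auto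
  also have "\<dots> = (\<Sum>k\<in>{n}. coeff p k * F (to_fract (monom 1 k) * R n))"
    using F_orth by (intro sum.mono_neutral_right) auto
  finally show "F (to_fract p * R n) = coeff p n * moment n"
    by (simp add: moment_def)
qed

text \<open>Compared with the denominator of \<open>R l\<close>, that of
  \<open>Phi k * Phit l\<close> lacks the factors \<open>f i\<close> for
  \<open>k \<le> i < l\<close>. Supplying them gives \<open>R l\<close> times a polynomial of degree
  at most \<open>k + (l - k) = l\<close>, to which \<open>poly_mult_R\<close> applies.\<close>

lemma Phi_Phit_le:
  assumes "k \<le> l"
  shows "Phi k * Phit l \<in> ratfun.span S"
    and "F (Phi k * Phit l) = lc k * (\<Prod>i=k..<l. coeff (f i) 1) * moment l"
proof -
  let ?P = "\<Prod>i=k..<l. f i"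
  have "(\<Prod>i<l. f i) = (\<Prod>i<k. f i) * ?P"
    using assms prod.atLeastLessThan_concat[of 0 k l f] by (simp add: lessThan_atLeast0)
  then have eq: "Phi k * Phit l = to_fract (r k * ?P) * R l"
    using f_nz g_nz by (simp add: Phi_def Phit_def R_eq to_fract_def eq_fract)
  have P: "degree ?P \<le> l - k" "coeff ?P (l - k) = (\<Prod>i=k..<l. coeff (f i) 1)"
    using prod_linear_top_coeff[of f, OF f_degree assms] by auto
  have deg: "degree (r k * ?P) \<le> l"
    using degree_mult_le[of "r k" ?P] r_degree[of k] P(1) assms by linarith
  have "coeff (r k * ?P) (k + (l - k)) = coeff (r k) k * coeff ?P (l - k)"
    using r_degree P(1) by (rule coeff_mult_at_bounds)
  then have "coeff (r k * ?P) l = lc k * (\<Prod>i=k..<l. coeff (f i) 1)"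
    using P(2) assms by (simp add: lc_def)
  with poly_mult_R[OF deg]
  show "Phi k * Phit l \<in> ratfun.span S"
    "F (Phi k * Phit l) = lc k * (\<Prod>i=k..<l. coeff (f i) 1) * moment l"
    by (simp_all only: eq)
qed

text \<open>The assumptions are symmetric in \<open>f\<close> and \<open>g\<close>, and exchanging
  these exchanges \<open>Phi\<close> and \<open>Phit\<close> but fixes \<open>lc\<close> and
  \<open>moment\<close>. The pairing for \<open>l \<le> k\<close> thus follows from the one for
  \<open>k \<le> l\<close>.\<close>

lemma swap_factors: "linear_factor_recurrence g f q r c F R S"
  using f_nz g_nz f_degree g_degree q_degree r_degree r_1 r_rec R_eq S_eq F F_orth
  by unfold_locales (simp_all add: mult.commute mult.left_commute)

lemma Phi_Phit_ge:
  assumes "l \<le> k"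
  shows "Phi k * Phit l \<in> ratfun.span S"
    and "F (Phi k * Phit l) = lc l * (\<Prod>i=l..<k. coeff (g i) 1) * moment k"
proof -
  interpret swap: linear_factor_recurrence g f q r c F R S
    by (rule swap_factors)
  have "swap.Phi = Phit" "swap.Phit = Phi"
    by (simp_all add: fun_eq_iff Phi_def Phit_def swap.Phi_def swap.Phit_def)
  moreover have "swap.lc = lc" "swap.moment = moment"
    by (simp_all add: fun_eq_iff lc_def swap.lc_def moment_def swap.moment_def)
  ultimately show "Phi k * Phit l \<in> ratfun.span S"
    "F (Phi k * Phit l) = lc l * (\<Prod>i=l..<k. coeff (g i) 1) * moment k"
    using swap.Phi_Phit_le[OF assms] by (simp_all add: mult.commute)
qed

lemma Phi_Phit_mem: "Phi k * Phit l \<in> ratfun.span S"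
  using Phi_Phit_le(1) Phi_Phit_ge(1) nat_le_linear by blast

section \<open>Recurrences for leading coefficients and moments\<close>

lemma lc_1: "lc 1 = coeff (q 0) 1 * lc 0"
  using coeff_mult_at_bounds[OF q_degree r_degree, of 0 0] r_1 by (simp add: lc_def)

lemma factor_product_top:
  "degree (f n * g n) \<le> 1 + 1" "coeff (f n * g n) (1 + 1) = coeff (f n) 1 * coeff (g n) 1"
  using degree_mult_le[of "f n" "g n"] f_degree[of n] g_degree[of n]
    coeff_mult_at_bounds[OF f_degree g_degree, of n n]
  by linarith+

lemma lc_rec:
  "lc (Suc (Suc n)) = coeff (q (Suc n)) 1 * lc (Suc n)
     + c (Suc (Suc n)) * (coeff (f n) 1 * coeff (g n) 1 * lc n)"
  using coeff_mult_at_bounds[OF q_degree r_degree, of "Suc n" "Suc n"]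
    coeff_mult_at_bounds[OF factor_product_top(1) r_degree, of n n] factor_product_top(2)[of n]
  by (simp add: lc_def r_rec)

text \<open>Division of \<open>r_rec\<close> by the denominator of \<open>R (Suc n)\<close> turns it
  into a relation between \<open>R (n + 2)\<close>, \<open>R (n + 1)\<close> and \<open>R n\<close>,
  because \<open>f n * g n\<close> cancels. After multiplication by \<open>z ^ n\<close> the
  polynomial multipliers have degrees at most \<open>n + 2\<close>, \<open>n + 1\<close> and
  \<open>n\<close>, so \<open>F\<close> sees exactly their top coefficients.\<close>

lemma moment_rec:
  "coeff (f (Suc n)) 1 * coeff (g (Suc n)) 1 * moment (Suc (Suc n))
     = coeff (q (Suc n)) 1 * moment (Suc n) + c (Suc (Suc n)) * moment n"
proof -
  let ?z = "monom 1 n :: complex poly"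
  let ?fg = "f (Suc n) * g (Suc n)"
  note fg = factor_product_top[of "Suc n"]
  have z: "degree ?z \<le> n" by (simp add: degree_monom_le)
  have deg_fgz: "degree (?fg * ?z) \<le> Suc (Suc n)"
    using degree_mult_le[of ?fg ?z] fg(1) z by linarith
  have deg_qz: "degree (q (Suc n) * ?z) \<le> Suc n"
    using degree_mult_le[of "q (Suc n)" ?z] q_degree[of "Suc n"] z by linarith
  let ?A = "to_fract (\<Prod>i<n. f i)" and ?B = "to_fract (\<Prod>i<n. g i)"
  have nz: "?A \<noteq> 0" "?B \<noteq> 0" "to_fract (f i) \<noteq> 0" "to_fract (g i) \<noteq> 0" for i
    using f_nz g_nz by simp_all
  have "to_fract ?fg * R (Suc (Suc n)) = to_fract (r (Suc (Suc n))) /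
      (?A * to_fract (f n) * (?B * to_fract (g n)))"
    using nz by (simp add: R_eq Fract_conv_to_fract divide_simps)
  also have "\<dots> = to_fract (q (Suc n)) * R (Suc n) + rscale (c (Suc (Suc n))) (R n)"
    using nz by (simp add: r_rec R_eq Fract_conv_to_fract to_fract_smult rscale_def
        divide_simps algebra_simps)
  finally have "to_fract (?fg * ?z) * R (Suc (Suc n)) =
      to_fract (q (Suc n) * ?z) * R (Suc n) + rscale (c (Suc (Suc n))) (to_fract ?z * R n)"
    by (simp add: algebra_simps rscale_mult_right)
  then have "F (to_fract (?fg * ?z) * R (Suc (Suc n))) =
      F (to_fract (q (Suc n) * ?z) * R (Suc n)) + c (Suc (Suc n)) * F (to_fract ?z * R n)"
    using F poly_mult_R(1)[OF deg_qz] poly_mult_R(1)[OF z] ratfun.span_scale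
    unfolding linear_functional_on_def by metis
  then have "coeff (?fg * ?z) (Suc (Suc n)) * moment (Suc (Suc n)) =
      coeff (q (Suc n) * ?z) (Suc n) * moment (Suc n) + c (Suc (Suc n)) * (coeff ?z n * moment n)"
    by (simp only: poly_mult_R(2)[OF deg_fgz] poly_mult_R(2)[OF deg_qz] poly_mult_R(2)[OF z])
  then show ?thesis
    using coeff_mult_at_bounds[OF fg(1) z] fg(2)
      coeff_mult_at_bounds[OF q_degree z, of "Suc n"]
    by simp
qed

section \<open>Biorthogonality of \<open>Phi\<close> and \<open>Psi\<close>\<close>

lemma Phi_mult_Psi_mem: "Phi k * Psi l \<in> ratfun.span S"
  unfolding Psi_def right_diff_distrib rscale_mult_right
  by (intro ratfun.span_diff ratfun.span_scale Phi_Phit_mem)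
     (auto split: nat.split simp: rscale_mult_right ratfun.span_zero
        intro: ratfun.span_scale Phi_Phit_mem)

lemma Phi_mult_Psi:
  "F (Phi k * Psi l) = coeff (g l) 1 * F (Phi k * Phit (Suc l)) - coeff (q l) 1 * F (Phi k * Phit l)
     - (case l of 0 \<Rightarrow> 0 | Suc i \<Rightarrow> c (Suc l) * coeff (f i) 1 * F (Phi k * Phit i))"
proof -
  have scale: "F (rscale a (Phi k * Phit i)) = a * F (Phi k * Phit i)" for a i
    using F Phi_Phit_mem unfolding linear_functional_on_def by blast
  have mem: "rscale a (Phi k * Phit i) \<in> ratfun.span S" for a i
    by (intro ratfun.span_scale Phi_Phit_mem)
  show ?thesis
    by (cases l) (simp_all add: Psi_def right_diff_distrib rscale_mult_right scale mem
        linear_functional_on_diff[OF F] ratfun.span_diff)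
qed

lemma Phi_Psi_less:
  assumes "k < l"
  shows "F (Phi k * Psi l) = 0"
proof -
  obtain i where l: "l = Suc i" "k \<le> i"
    using assms by (cases l) auto
  let ?P = "\<Prod>j=k..<i. coeff (f j) 1"
  \<comment> \<open>As \<open>k \<le> i\<close>, all three pairings fall under
    \<open>Phi_Phit_le\<close> and share the factor in front; the bracket is
    \<open>moment_rec\<close> at \<open>i\<close>.\<close>
  have "F (Phi k * Psi l) = lc k * ?P * coeff (f i) 1 *
      (coeff (f l) 1 * coeff (g l) 1 * moment (Suc l)
        - coeff (q l) 1 * moment l - c (Suc l) * moment i)"
    using l by (simp add: Phi_mult_Psi Phi_Phit_le(2) algebra_simps)
  then show ?thesis
    using moment_rec[of i] l by simp
qed

text \<open>Every \<open>Phit\<close> occurring in \<open>Psi l\<close> has index at most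
  \<open>k\<close>, so all pairings fall under \<open>Phi_Phit_ge\<close> and contain
  \<open>moment k\<close>. What remains is \<open>lc_rec\<close>, or \<open>lc_1\<close> when
  \<open>l = 0\<close>.\<close>

lemma Phi_Psi_greater:
  assumes "l < k"
  shows "F (Phi k * Psi l) = 0"
proof (cases l)
  case 0
  have "(\<Prod>j=0..<k. coeff (g j) 1) = coeff (g 0) 1 * (\<Prod>j=Suc 0..<k. coeff (g j) 1)"
    using assms by (intro prod.atLeast_Suc_lessThan) auto
  then show ?thesis
    using 0 assms lc_1 by (simp add: Phi_mult_Psi Phi_Phit_ge(2) Suc_leI)
next
  case (Suc i)
  let ?Q = "\<Prod>j=Suc l..<k. coeff (g j) 1"
  have "(\<Prod>j=l..<k. coeff (g j) 1) = coeff (g l) 1 * ?Q"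
    using assms by (intro prod.atLeast_Suc_lessThan) auto
  moreover have "(\<Prod>j=i..<k. coeff (g j) 1) = coeff (g i) 1 * (\<Prod>j=l..<k. coeff (g j) 1)"
    using assms Suc by (subst prod.atLeast_Suc_lessThan) auto
  ultimately have "F (Phi k * Psi l) = coeff (g l) 1 * ?Q * moment k *
      (lc (Suc l) - coeff (q l) 1 * lc l - c (Suc l) * (coeff (f i) 1 * coeff (g i) 1 * lc i))"
    using Suc assms by (simp add: Phi_mult_Psi Phi_Phit_ge(2) algebra_simps)
  then show ?thesis
    using lc_rec[of i] Suc by simp
qed

lemma Phi_Psi_diag: "F (Phi l * Psi l) = casorati l"
proof (cases l)
  case 0
  then show ?thesis
    using lc_1 by (simp add: Phi_mult_Psi Phi_Phit_le(2) casorati_def algebra_simps)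
next
  case (Suc i)
  \<comment> \<open>The diagonal lies between the two regimes: the term with
    \<open>Phit (Suc l)\<close> needs \<open>Phi_Phit_le\<close>, the one with \<open>Phit i\<close>
    needs \<open>Phi_Phit_ge\<close>. The last two terms then combine to
    \<open>lc (Suc l) * moment l\<close> by \<open>lc_rec\<close>.\<close>
  then have "F (Phi l * Psi l) = coeff (g l) 1 * (lc l * coeff (f l) 1 * moment (Suc l))
      - coeff (q l) 1 * (lc l * moment l)
      - c (Suc l) * coeff (f i) 1 * (lc i * coeff (g i) 1 * moment l)"
    by (simp add: Phi_mult_Psi Phi_Phit_le(2) Phi_Phit_ge(2)[of i "Suc i"])
  then show ?thesis
    using lc_rec[of i] Suc by (simp add: casorati_def algebra_simps)
qed

text \<open>When the newest entry of each sequence is expanded by its recurrence, the two terms with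
  \<open>coeff (q (Suc l)) 1\<close> cancel.\<close>

lemma casorati_Suc: "casorati (Suc l) = - c (Suc (Suc l)) * casorati l"
proof -
  have "casorati (Suc l) = lc (Suc l) *
      (coeff (f (Suc l)) 1 * coeff (g (Suc l)) 1 * moment (Suc (Suc l))) - lc (Suc (Suc l)) * moment (Suc l)"
    by (simp add: casorati_def)
  then show ?thesis
    unfolding moment_rec lc_rec by (simp add: casorati_def algebra_simps)
qed

lemma casorati_eq: "casorati l = (- 1) ^ l * (\<Prod>i=2..Suc l. c i) * casorati 0"
  by (induction l) (simp_all add: casorati_Suc)

theorem biorthogonality:
  "F (Phi k * Psi l) = (- 1) ^ l * (\<Prod>i=2..Suc l. c i) * casorati 0 * of_bool (k = l)"
  using Phi_Psi_less[of k l] Phi_Psi_greater[of l k] Phi_Psi_diag[of l] casorati_eq[of l]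
  by (cases k l rule: linorder_cases) auto

end

section \<open>The concrete factors and the transfer to \<open>psi_tilde\<close>\<close>

lemma degree_lin_rlin: "degree (lin a) \<le> 1" "degree (rlin a) \<le> 1"
  by (simp_all add: lin_def rlin_def)

lemma lin_rlin_nonzero: "lin a \<noteq> 0" "rlin a \<noteq> 0"
  by (simp_all add: lin_def rlin_def)

lemma coeff_lin_rlin: "coeff (lin a) (Suc 0) = 1" "coeff (rlin a) (Suc 0) = - cnj a"
  by (simp_all add: lin_def rlin_def)

lemma prod_interleave:
  fixes a b :: "nat \<Rightarrow> 'a::comm_monoid_mult"
  shows "(\<Prod>i<n. if even i then a (i div 2) else b (i div 2)) =
    (\<Prod>j<(n + 1) div 2. a j) * (\<Prod>j<n div 2. b j)"
  by (induction n) (auto simp: ac_simps elim!: evenE oddE)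

lemma prod_shift_index:
  fixes h :: "nat \<Rightarrow> 'a::comm_monoid_mult"
  shows "(\<Prod>j=1..n. h j) = (\<Prod>j<n. h (Suc j))"
  by (simp add: prod.atLeast1_atMost_eq)

theorem theorem3p2:
  fixes \<alpha> \<beta> c d e :: "nat \<Rightarrow> complex"
    and r :: "nat \<Rightarrow> complex poly"
    and \<phi> :: "nat \<Rightarrow> ratfun"
    and \<LL> \<NN> :: "ratfun \<Rightarrow> complex"
    and m :: "nat \<Rightarrow> complex"
  assumes alpha_nz: "\<And>j. j \<ge> 1 \<Longrightarrow> \<alpha> j \<noteq> 0"
    and beta_nz: "\<And>j. j \<ge> 1 \<Longrightarrow> \<beta> j \<noteq> 0"
    and beta_0: "\<beta> 0 = 0"
    and L: "hermitian_posdef_functional (ratfun.span (range (u_basis \<alpha> \<beta>))) \<LL>"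
    and phi: "gram_schmidt \<LL> (u_basis \<alpha> \<beta>) \<phi>"
    and phi_0: "\<phi> 0 = 1"
    and phi_even: "\<And>j. \<phi> (2 * j) =
          Fract (r (2 * j)) ((\<Prod>k=1..j. lin (\<alpha> k)) * (\<Prod>k=1..j. rlin (\<beta> k)))"
    and phi_odd: "\<And>j. \<phi> (2 * j + 1) =
          Fract (r (2 * j + 1)) ((\<Prod>k=1..j + 1. lin (\<alpha> k)) * (\<Prod>k=1..j. rlin (\<beta> k)))"
    and r_degree: "\<And>n. degree (r n) \<le> n"
    and r_0: "r 0 = 1"
    and c_nz: "\<And>j. j \<ge> 1 \<Longrightarrow> c j \<noteq> 0"
    and r_odd: "\<And>n. r (2 * n + 1) =
          ([:e (2 * n + 1):] + smult (d (2 * n + 1)) (lin (\<beta> n))) * r (2 * n)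
          + smult (c (2 * n + 1)) (rlin (\<alpha> n) * rlin (\<beta> n) * prev r (2 * n))"
    and r_even: "\<And>n. r (2 * n + 2) =
          ([:e (2 * n + 2):] + smult (d (2 * n + 2)) (rlin (\<alpha> (n + 1)))) * r (2 * n + 1)
          + smult (c (2 * n + 2)) (lin (\<alpha> (n + 1)) * lin (\<beta> n) * r (2 * n))"
    and reg_even: "\<And>n. n \<ge> 1 \<Longrightarrow>
          poly (r (2 * n)) (\<alpha> n) \<noteq> 0 \<and> poly (r (2 * n)) (1 / cnj (\<beta> n)) \<noteq> 0 \<and>
          poly (r (2 * n)) (\<beta> (n - 1)) \<noteq> 0 \<and> poly (r (2 * n)) (1 / cnj (\<alpha> n)) \<noteq> 0"
    and reg_odd: "\<And>n. poly (r (2 * n + 1)) (\<alpha> (n + 1)) \<noteq> 0 \<and> poly (r (2 * n + 1)) (\<beta> n) \<noteq> 0"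
    and reg_odd': "\<And>n. n \<ge> 1 \<Longrightarrow>
          poly (r (2 * n + 1)) (1 / cnj (\<beta> n)) \<noteq> 0 \<and> poly (r (2 * n + 1)) (1 / cnj (\<alpha> n)) \<noteq> 0"
    and N: "linear_functional_on (ratfun.span {zO \<alpha> \<beta> r k n | k n. k \<le> n}) \<NN>"
    and N_orth: "\<And>n k. k < n \<Longrightarrow> \<NN> (zO \<alpha> \<beta> r k n) = 0"
    and m_def: "\<And>n. m n = \<NN> (zO \<alpha> \<beta> r n n)"
    and m_init: "m 1 \<noteq> d 1 * m 0"
  shows "\<forall>n l.
      \<NN> (\<phi> (2 * n) * psi_tilde \<alpha> \<beta> c d r l) =
        (\<Prod>i=2..2 * n + 1. c i) * (m 1 * coeff (r 0) 0 - m 0 * coeff (r 1) 1)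
          / chi \<alpha> \<beta> (2 * n + 1) * of_bool (2 * n = l) \<and>
      \<NN> (\<phi> (2 * n + 1) * psi_tilde \<alpha> \<beta> c d r l) =
        (\<Prod>i=2..2 * n + 2. c i) * (m 1 * coeff (r 0) 0 - m 0 * coeff (r 1) 1)
          / chi \<alpha> \<beta> (2 * n + 2) * of_bool (2 * n + 1 = l)"
proof -
  \<comment> \<open>\<open>f i\<close> and \<open>g i\<close> are the factors gained by the
    denominators of \<open>\<phi>\<close> and \<open>phi_tilde\<close> from index \<open>i\<close>
    to \<open>i + 1\<close>. The index of \<open>\<beta>\<close> in \<open>g\<close> is not shifted,
    as that product starts at \<open>\<beta> 0\<close>.\<close>
  define f where "f i = (if even i then lin (\<alpha> (Suc (i div 2))) else rlin (\<beta> (Suc (i div 2))))" for i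
  define g where "g i = (if even i then lin (\<beta> (i div 2)) else rlin (\<alpha> (Suc (i div 2))))" for i
  \<comment> \<open>The linear polynomial multiplied by \<open>d (Suc i)\<close> is
    \<open>g i\<close> itself, so the top coefficient of \<open>q i\<close> is
    \<open>d (Suc i)\<close> times that of \<open>g i\<close>.\<close>
  define q where "q i = [:e (Suc i):] + smult (d (Suc i))
      (if even i then lin (\<beta> (i div 2)) else rlin (\<alpha> (Suc (i div 2))))" for i
  have prod_f: "(\<Prod>i<n. f i) = (\<Prod>j=1..(n + 1) div 2. lin (\<alpha> j)) * (\<Prod>j=1..n div 2. rlin (\<beta> j))" for n
    unfolding f_def prod_shift_index by (rule prod_interleave)
  have prod_g: "(\<Prod>i<n. g i) = (\<Prod>j<(n + 1) div 2. lin (\<beta> j)) * (\<Prod>j=1..n div 2. rlin (\<alpha> j))" for n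
    unfolding g_def prod_shift_index by (rule prod_interleave)
  \<comment> \<open>The quadratic factor in front of \<open>r n\<close> is \<open>f n * g n\<close>
    for both parities. Odd \<open>n\<close> uses the odd recurrence one step later; its instance at
    0, where \<open>prev\<close> vanishes, supplies \<open>r 1 = q 0 * r 0\<close>.\<close>
  have rec: "r (Suc (Suc n)) = q (Suc n) * r (Suc n) + smult (c (Suc (Suc n))) (f n * g n * r n)" for n
  proof (cases "even n")
    case True
    then obtain k where n: "n = 2 * k" by (elim evenE)
    show ?thesis
      using r_even[of k] by (simp add: n f_def g_def q_def)
  next
    case False
    then obtain k where n: "n = 2 * k + 1" by (elim oddE)
    show ?thesis
      using r_odd[of "Suc k"] by (simp add: n f_def g_def q_def prev_def ac_simps)
  qed
  have ratO: "ratO \<alpha> \<beta> r n = Fract (r n) ((\<Prod>i<n. f i) * (\<Prod>i<n. g i))" for n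
    by (auto simp: ratO_def prod_f prod_g r_0 One_fract_def ac_simps)
  interpret P: linear_factor_recurrence f g q r c \<NN> "ratO \<alpha> \<beta> r" "{zO \<alpha> \<beta> r k n | k n. k \<le> n}"
  proof
    show "degree (q n) \<le> 1" for n
      unfolding q_def
      by (intro degree_add_le order.trans[OF degree_smult_le]) (use degree_lin_rlin in auto)
    show "r 1 = q 0 * r 0"
      using r_odd[of 0] by (simp add: q_def prev_def)
    show "\<NN> (to_fract (monom 1 k) * ratO \<alpha> \<beta> r n) = 0" if "k < n" for k n
      using N_orth[OF that] by (simp add: zO_def)
  qed (use r_degree rec ratO N degree_lin_rlin lin_rlin_nonzero in \<open>simp_all add: f_def g_def zO_def\<close>)
  have Phi: "P.Phi n = \<phi> n" for n
    by (cases "even n") (auto simp: P.Phi_def prod_f phi_even phi_odd[simplified] elim!: evenE oddE)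
  have Phit: "phi_tilde \<alpha> \<beta> r n = P.Phit n" for n
    by (auto simp: phi_tilde_def P.Phit_def prod_g r_0 One_fract_def ac_simps)
  have chi_odd: "chi \<alpha> \<beta> (Suc (2 * j)) = chi \<alpha> \<beta> (2 * j) * cnj (\<alpha> (Suc j))" for j
    by (simp add: chi_def)
  have chi_even: "chi \<alpha> \<beta> (Suc (Suc (2 * j))) = chi \<alpha> \<beta> (2 * j) * cnj (\<alpha> (Suc j)) / cnj (\<beta> (Suc j))" for j
    by (simp add: chi_def)
  have chi_nz: "chi \<alpha> \<beta> n \<noteq> 0" for n
    using alpha_nz beta_nz by (auto simp: chi_def)
  have a_nz: "\<alpha> (Suc j) \<noteq> 0" and b_nz: "\<beta> (Suc j) \<noteq> 0" for j
    using alpha_nz beta_nz by auto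
  \<comment> \<open>The sign comes from the top coefficient \<open>- cnj a\<close> of
    \<open>rlin a\<close>. For even \<open>l > 0\<close>, one factor of the squared
    \<open>cnj (\<beta> j)\<close> is the top coefficient of \<open>f (l - 1)\<close> up to sign,
    the other comes from the quotient of \<open>chi (l - 1)\<close> and
    \<open>chi (l + 1)\<close>.\<close>
  have psi: "psi_tilde \<alpha> \<beta> c d r l = rscale ((- 1) ^ l / chi \<alpha> \<beta> (Suc l)) (P.Psi l)" for l
  proof (cases "even l")
    case True
    then obtain j where l: "l = 2 * j" by (elim evenE)
    show ?thesis
    proof (cases j)
      case 0
      then show ?thesis
        using a_nz[of 0] by (simp add: l psi_tilde_def P.Psi_def J_tilde_def Phit prev_def chi_def
            ratfun.scale_right_diff_distrib f_def g_def q_def coeff_lin_rlin)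
    next
      case (Suc k)
      then show ?thesis
        using a_nz[of k] b_nz[of k] a_nz[of j] chi_nz[of "2 * k"]
        by (simp add: l psi_tilde_def P.Psi_def J_tilde_def Phit prev_def chi_odd chi_even
            chi_odd[of "Suc k", simplified] ratfun.scale_right_distrib
            ratfun.scale_right_diff_distrib f_def g_def q_def coeff_lin_rlin power2_eq_square)
          (simp add: mult.commute)
    qed
  next
    case False
    then obtain j where l: "l = Suc (2 * j)" by (metis oddE Suc_eq_plus1)
    show ?thesis
      using a_nz[of j] b_nz[of j] chi_nz[of "2 * j"]
      by (simp add: l psi_tilde_def P.Psi_def J_tilde_def Phit chi_odd chi_even
          ratfun.scale_right_diff_distrib f_def g_def q_def coeff_lin_rlin)
        (simp add: mult.commute)
  qed
  have moment: "P.moment n = m n" for n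
    by (simp add: P.moment_def m_def zO_def)
  \<comment> \<open>Both \<open>f 0\<close> and \<open>g 0\<close> are monic.\<close>
  have casorati: "P.casorati 0 = m 1 * coeff (r 0) 0 - m 0 * coeff (r 1) 1"
    by (simp add: P.casorati_def P.lc_def moment f_def g_def coeff_lin_rlin)
  have main: "\<NN> (\<phi> k * psi_tilde \<alpha> \<beta> c d r l) =
      (\<Prod>i=2..Suc k. c i) * (m 1 * coeff (r 0) 0 - m 0 * coeff (r 1) 1)
        / chi \<alpha> \<beta> (Suc k) * of_bool (k = l)" for k l
  proof -
    have "\<NN> (\<phi> k * psi_tilde \<alpha> \<beta> c d r l) = (- 1) ^ l / chi \<alpha> \<beta> (Suc l) * \<NN> (P.Phi k * P.Psi l)"
      unfolding psi rscale_mult_right Phi[symmetric]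
      using N P.Phi_mult_Psi_mem unfolding linear_functional_on_def by blast
    also have "\<dots> = ((- 1) ^ l * (- 1) ^ l) * (\<Prod>i=2..Suc l. c i) * P.casorati 0
        / chi \<alpha> \<beta> (Suc l) * of_bool (k = l)"
      by (simp add: P.biorthogonality)
    \<comment> \<open>The sign from rescaling \<open>Psi\<close> meets the sign accumulated in
      \<open>casorati_eq\<close>.\<close>
    also have "(- 1) ^ l * (- 1) ^ l = (1 :: complex)"
      by (simp flip: power_mult_distrib)
    finally show ?thesis
      by (auto simp: casorati)
  qed
  show ?thesis
    using main[of "2 * n" for n] main[of "2 * n + 1" for n] by simp
qed

end
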